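(* Let $\ell\ge 1$ be an integer and fix $i\in\{0,1,\dots,\ell\}$. Set $k_i=1$ and $k_j=0$ for all $j\neq i$ (so $k=1$). For integers $j,n\ge 0$ let $F^{\ast\ast}(i,j,n)$ be the number of admissible frequency arrays $f$ of type $(\ast\ast)$ (defined in the context) with number of parts $j$ and weight $n$, and let $$P^{\ast\ast}_i(z)=P^{\ast\ast}_i(z;q)=\sum_{j,n\ge 0}F^{\ast\ast}(i,j,n)\,q^n z^j.$$ Then $$P^{\ast\ast}_i(z)=\sum_{n_1,\dots,n_\ell\ge 0}\frac{q^{N_1^2+N_2^2+\cdots+N_\ell^2+L^{\ast\ast}_{\ell,i}(N_1,\dots,N_\ell)}\,z^{N_1}}{(q;q)_{n_1}(q;q)_{n_2}\cdots(q;q)_{n_{\ell-1}}(q^2;q^2)_{n_\ell}},$$ where $N_s=n_s+n_{s+1}+\cdots+n_\ell$ for $s=1,\dots,\ell$, and the linear forms $L^{\ast\ast}_{\ell,i}$ are $$L^{\ast\ast}_{\ell,0}=N_1+\cdots+N_\ell+N_1,\quad L^{\ast\ast}_{\ell,\ell}=N_2+\cdots+N_\ell,\quad L^{\ast\ast}_{\ell,1}=N_3+\cdots+N_\ell+N_2,\quad L^{\ast\ast}_{\ell,\ell-1}=N_4+\cdots+N_\ell,\ \dots$$ that is, in general: if $0\le i\le \ell/2$ then $L^{\ast\ast}_{\ell,i}=N_{2i+1}+N_{2i+2}+\cdots+N_\ell+N_{i+1}$, and if $\ell/2<i\le\ell$, writing $m=\ell-i$, then $L^{\ast\ast}_{\ell,i}=N_{2m+2}+N_{2m+3}+\cdots+N_\ell$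 (empty sums are $0$).
   Context: CMPP diagram. Fix an integer $\ell\ge1$ and nonnegative integers $k_0,k_1,\dots,k_\ell$ (initial conditions), $k=k_0+\cdots+k_\ell$. Consider rows $r=0,1,\dots,2\ell-1$ (row $0$ at the bottom). A cell is a pair $(r,x)$ with $x\in\mathbb{Z}$, $x\equiv r \pmod 2$. Cells $(r,x)$ with $x\ge1$ are part positions: $(r,x)$ is one copy of the positive integer $x$, and cells with the same $x$ but different $r$ are distinct kinds of parts. A (colored) partition is a finitely supported function $f$ from part positions to nonnegative integers (frequencies); its weight is $\sum x\,f(r,x)$ and its number of parts is $\sum f(r,x)$. Define the value of each cell by $v(r,x)=f(r,x)$ if $x\ge1$, $v(0,0)=k_0$, $v(2j-1,-1)=k_j$ for $j=1,\dots,\ell$, and $v(r,x)=0$ otherwise (initial conditions do not contribute to weight or number of parts). A downward path is a sequence $(x_{2\ell-1},\dots,x_0)$ with $x_r\equiv r\pmod 2$ and $|x_r-x_{r-1}|=1$ for all $r$. The array $f$ is admissible if $\sum_{r=0}^{2\ell-1}v(r,x_r)\le k$ for every downward path. Type $(\ast\ast)$: the paper reflects this diagram in a horizontal line (so the even row carrying $k_0$ becomes the top row and the odd row carrying $k_\ell$ the bottom row) and deletes the row of even integers adjacent to $k_0$; since the path condition is unchanged by reversing the order of the rows, this means: admissible arrays $f$ with $f(0,x)=0$ for all $x$ (the initial condition $k_0$ at cell $(0,0)$ remains). Notation: $(a;q)_n=\prod_{t=1}^{n}(1-aq^{t-1})$.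
   Formalization: For 2 ≤ i ≤ ℓ/2 the printed extra term N_{i+1} in the linear form is replaced by N_{2i}; the printed form is false there (ℓ=4, i=2: the coefficient of z q^3 is 3, but the printed sum gives 2). *)

theory Defs
  imports "HOL-Analysis.Analysis" "HOL-Computational_Algebra.Formal_Power_Series"
begin

definition part_positions :: "nat \<Rightarrow> (nat \<times> int) set" where
  "part_positions l = {(r, x). r < 2 * l \<and> 1 \<le> x \<and> even (x - int r)}"

(* Arrays vanish outside the part positions, so that each one is represented exactly once. *)
definition colored_partition :: "nat \<Rightarrow> (nat \<times> int \<Rightarrow> nat) \<Rightarrow> bool" where
  "colored_partition l f \<longleftrightarrow>
     finite {p. f p \<noteq> 0} \<and> (\<forall>p. p \<notin> part_positions l \<longrightarrow> f p = 0)"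

definition weight :: "(nat \<times> int \<Rightarrow> nat) \<Rightarrow> nat" where
  "weight f = (\<Sum>(r, x) \<in> {p. f p \<noteq> 0}. nat x * f (r, x))"

definition num_parts :: "(nat \<times> int \<Rightarrow> nat) \<Rightarrow> nat" where
  "num_parts f = (\<Sum>p \<in> {p. f p \<noteq> 0}. f p)"

(* For r = 2 * j - 1 the index (r + 1) div 2 is j. *)
definition cell_value :: "(nat \<Rightarrow> nat) \<Rightarrow> (nat \<times> int \<Rightarrow> nat) \<Rightarrow> nat \<Rightarrow> int \<Rightarrow> nat" where
  "cell_value k f r x =
     (if x \<ge> 1 then f (r, x)
      else if r = 0 \<and> x = 0 then k 0
      else if odd r \<and> x = -1 then k ((r + 1) div 2)
      else 0)"

(* A path lists the column met in each row; its values in rows \<ge> 2 * l are irrelevant. *)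
definition downward_path :: "nat \<Rightarrow> (nat \<Rightarrow> int) \<Rightarrow> bool" where
  "downward_path l x \<longleftrightarrow>
     (\<forall>r < 2 * l. even (x r - int r)) \<and>
     (\<forall>r. 1 \<le> r \<and> r < 2 * l \<longrightarrow> \<bar>x r - x (r - 1)\<bar> = 1)"

definition admissible :: "nat \<Rightarrow> (nat \<Rightarrow> nat) \<Rightarrow> (nat \<times> int \<Rightarrow> nat) \<Rightarrow> bool" where
  "admissible l k f \<longleftrightarrow> colored_partition l f \<and>
     (\<forall>x. downward_path l x \<longrightarrow> (\<Sum>r < 2 * l. cell_value k f r (x r)) \<le> (\<Sum>j \<le> l. k j))"

(* Type ( ** ): no parts in row 0, while the initial condition k 0 at cell (0, 0) remains. *)
definition admissible_ss :: "nat \<Rightarrow> (nat \<Rightarrow> nat) \<Rightarrow> (nat \<times> int \<Rightarrow> nat) \<Rightarrow> bool" where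
  "admissible_ss l k f \<longleftrightarrow> admissible l k f \<and> (\<forall>x. f (0, x) = 0)"

definition F_ss :: "nat \<Rightarrow> nat \<Rightarrow> nat \<Rightarrow> nat \<Rightarrow> nat" where
  "F_ss l i j n =
     card {f. admissible_ss l (\<lambda>s. if s = i then 1 else 0) f \<and> num_parts f = j \<and> weight f = n}"

(* Bivariate formal power series: outer variable z, inner variable q. *)
definition P_ss :: "nat \<Rightarrow> nat \<Rightarrow> rat fps fps" where
  "P_ss l i = Abs_fps (\<lambda>j. Abs_fps (\<lambda>n. of_nat (F_ss l i j n)))"

definition qpoch :: "'a::comm_ring_1 \<Rightarrow> 'a \<Rightarrow> nat \<Rightarrow> 'a" where
  "qpoch a q n = (\<Prod>t = 1..n. 1 - a * q ^ (t - 1))"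

definition N_part :: "nat \<Rightarrow> (nat \<Rightarrow> nat) \<Rightarrow> nat \<Rightarrow> nat" where
  "N_part l n s = (\<Sum>t = s..l. n t)"

(* The single extra term is N_1 for i = 0 and N_(2i) for 1 \<le> i \<le> l/2.  It is sometimes given
   as N_(i+1), which agrees for i \<le> 1 but yields a false identity for 2 \<le> i \<le> l/2:
   for 1 \<le> i \<le> l, reflecting rows 1, ..., 2l-1 exchanges the initial conditions i and l+1-i,
   so the forms for i and l+1-i have to give the same series. *)
definition L_ss :: "nat \<Rightarrow> nat \<Rightarrow> (nat \<Rightarrow> nat) \<Rightarrow> nat" where
  "L_ss l i N =
     (if i = 0 then (\<Sum>s = 1..l. N s) + N 1
      else if 2 * i \<le> l then (\<Sum>s = 2 * i + 1..l. N s) + N (2 * i)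
      else (\<Sum>s = 2 * (l - i) + 2..l. N s))"

definition multisum_term :: "nat \<Rightarrow> nat \<Rightarrow> (nat \<Rightarrow> nat) \<Rightarrow> rat fps fps" where
  "multisum_term l i n =
     fps_const (fps_X ^ ((\<Sum>s = 1..l. (N_part l n s)\<^sup>2) + L_ss l i (N_part l n)) /
                ((\<Prod>s = 1..<l. qpoch fps_X fps_X (n s)) * qpoch (fps_X\<^sup>2) (fps_X\<^sup>2) (n l)))
     * fps_X ^ N_part l n 1"

end

theory Submission
  imports Defs
begin

text \<open>Since \<open>k = 1\<close>, admissibility means that all frequencies are at most 1 and no two nonzero cells
  (the initial one included) lie on a common path, that is, any two cells satisfy
  \<open>\<bar>x - x'\<bar> > \<bar>r - r'\<bar>\<close>.  By the triangle inequality it suffices to require this for cells that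
  are neighbours in the order of the columns, so the arrays are chains that start at the initial
  cell.  Removing the first part of a chain gives for the generating functions \<open>G\<^sub>j(r)\<close> of chains with
  \<open>j\<close> parts that start in row \<open>r\<close> (divided by their common power of \<open>q\<close>) the recurrence
  \<open>(1 - q ^ (2 j)) G\<^sub>j(r) = (\<Sum>s. q ^ (j \<bar>r - s\<bar>) G\<^sub>j\<^sub>-\<^sub>1(s))\<close>.  Its kernel is the Green function of
  a tridiagonal operator, so it amounts to
  \<open>q ^ j (G\<^sub>j(r - 1) + G\<^sub>j(r + 1)) + G\<^sub>j\<^sub>-\<^sub>1(r) = (1 + q ^ (2 j)) G\<^sub>j(r)\<close> with boundary conditions.
  The multisums satisfy this three-term relation by induction on \<open>l\<close>: raising \<open>l\<close> and the row by 1 is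
  a Bailey-type transformation \<open>h \<mapsto> (\<Sum>m\<le>j. q ^ m\<^sup>2 h m / (q; q)\<^sub>j\<^sub>-\<^sub>m)\<close>, which preserves it.\<close>

section \<open>The Bailey-type transformation and the relations it yields\<close>

text \<open>In the application \<open>p d\<close> is \<open>1 / (q; q)_d\<close>, \<open>v\<close>
  is a row and \<open>u\<close> the sum of its two neighbours. \<open>rec0\<close> is
  \<open>rec\<close> at \<open>m = -1\<close> with \<open>v (-1) = 0\<close>; transforming it as
  well allows the step to be iterated.\<close>

lemma bailey_step_tridiagonal:
  fixes q :: "'a::comm_ring_1" and u v p :: "nat \<Rightarrow> 'a"
  assumes p: "\<And>d. p d = p (Suc d) * (1 - q ^ Suc d)"
  assumes rec0: "u 0 = 2 * v 0"
  assumes rec: "\<And>m. q ^ Suc m * u (Suc m) + v m = (1 + q ^ (2 * Suc m)) * v (Suc m)"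
  defines "g f j \<equiv> (\<Sum>m\<le>j. q ^ (m\<^sup>2) * p (j - m) * f m)"
  shows "g u 0 = 2 * g v 0"
    and "q ^ Suc j * g u (Suc j) + g v j = (1 + q ^ (2 * Suc j)) * g v (Suc j)"
proof -
  show "g u 0 = 2 * g v 0"
    by (simp add: g_def rec0 mult_ac)
  define J where "J = Suc j"
  \<comment> \<open>By \<open>p\<close>, the weight of level \<open>j\<close> is that of level
    \<open>J\<close> times \<open>1 - q ^ (J - m)\<close>, a factor that vanishes at the added index
    \<open>m = J\<close>.\<close>
  have prev: "(\<Sum>m\<le>j. c m * p (j - m)) = (\<Sum>m\<le>J. c m * ((1 - q ^ (J - m)) * p (J - m)))" for c :: "nat \<Rightarrow> 'a"
  proof -
    have "(\<Sum>m\<le>J. c m * ((1 - q ^ (J - m)) * p (J - m))) = (\<Sum>m\<le>j. c m * ((1 - q ^ (J - m)) * p (J - m)))"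
      by (simp add: J_def)
    also have "\<dots> = (\<Sum>m\<le>j. c m * p (j - m))"
      by (intro sum.cong refl) (subst (2) p, simp add: J_def Suc_diff_le mult_ac)
    finally show ?thesis by simp
  qed
  \<comment> \<open>The added sum supplies the \<open>v m\<close> that \<open>rec\<close> needs next
    to \<open>q ^ Suc m * u (Suc m)\<close>: its exponent is
    \<open>j - m + (Suc m)\<^sup>2\<close>.\<close>
  have A: "q ^ J * g u J + (\<Sum>m\<le>j. (q ^ (J + m\<^sup>2 + m) * v m) * p (j - m))
      = (\<Sum>m\<le>J. q ^ (J - m + m\<^sup>2) * (1 + q ^ (2 * m)) * v m * p (J - m))"
  proof -
    have "q ^ J * g u J = (\<Sum>m\<le>J. q ^ (J - m + m\<^sup>2) * p (J - m) * (q ^ m * u m))"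
      unfolding g_def sum_distrib_left
    proof (intro sum.cong refl)
      fix m assume "m \<in> {..J}"
      then have "q ^ J = q ^ (J - m) * q ^ m" by (simp flip: power_add)
      then show "q ^ J * (q ^ m\<^sup>2 * p (J - m) * u m) = q ^ (J - m + m\<^sup>2) * p (J - m) * (q ^ m * u m)"
        by (simp add: power_add mult_ac)
    qed
    also have "\<dots> = q ^ J * p J * u 0 + (\<Sum>m\<le>j. q ^ (j - m + (Suc m)\<^sup>2) * p (j - m) * (q ^ Suc m * u (Suc m)))"
      unfolding J_def by (subst sum.atMost_Suc_shift) simp
    finally have "q ^ J * g u J + (\<Sum>m\<le>j. (q ^ (J + m\<^sup>2 + m) * v m) * p (j - m)) = \<dots>
       + (\<Sum>m\<le>j. (q ^ (J + m\<^sup>2 + m) * v m) * p (j - m))" by simp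
    also have "\<dots> = q ^ J * p J * (2 * v 0) + (\<Sum>m\<le>j. q ^ (j - m + (Suc m)\<^sup>2) * p (j - m) * (q ^ Suc m * u (Suc m) + v m))"
    proof -
      have "j - m + (Suc m)\<^sup>2 = J + m\<^sup>2 + m" if "m \<le> j" for m
        using that by (simp add: J_def power2_eq_square)
      then show ?thesis
        by (simp only: rec0 add.assoc sum.distrib distrib_left) (simp add: mult_ac)
    qed
    also have "\<dots> = (\<Sum>m\<le>J. q ^ (J - m + m\<^sup>2) * (1 + q ^ (2 * m)) * v m * p (J - m))"
      unfolding rec J_def sum.atMost_Suc_shift by (simp add: mult_ac)
    finally show ?thesis .
  qed
  have B: "g v j = (\<Sum>m\<le>J. (q ^ m\<^sup>2 * v m) * ((1 - q ^ (J - m)) * p (J - m)))"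
    unfolding g_def prev[symmetric] by (intro sum.cong refl) (simp add: mult_ac)
  have "q ^ J * g u J + g v j = (1 + q ^ (2 * J)) * g v J"
  proof -
    have "q ^ J * g u J + g v j = (\<Sum>m\<le>J. q ^ (J - m + m\<^sup>2) * (1 + q ^ (2 * m)) * v m * p (J - m))
       + (\<Sum>m\<le>J. (q ^ m\<^sup>2 * v m) * ((1 - q ^ (J - m)) * p (J - m)))
       - (\<Sum>m\<le>J. (q ^ (J + m\<^sup>2 + m) * v m) * ((1 - q ^ (J - m)) * p (J - m)))"
      using A unfolding B prev by (simp add: eq_diff_eq add_ac)
    \<comment> \<open>No shift of the index remains: for each \<open>m\<close> the coefficients of
      \<open>v m\<close> agree, because \<open>q ^ d\<close> and \<open>q ^ (d + 2 * m)\<close>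
      cancel.\<close>
    also have "\<dots> = (1 + q ^ (2 * J)) * g v J"
      unfolding g_def sum_distrib_left sum.distrib[symmetric] sum_subtractf[symmetric]
    proof (intro sum.cong refl)
      fix m assume "m \<in> {..J}"
      then obtain d where d: "J = m + d" by (auto simp: le_iff_add)
      show "q ^ (J - m + m\<^sup>2) * (1 + q ^ (2 * m)) * v m * p (J - m) +
         q ^ m\<^sup>2 * v m * ((1 - q ^ (J - m)) * p (J - m)) -
         q ^ (J + m\<^sup>2 + m) * v m * ((1 - q ^ (J - m)) * p (J - m)) =
         (1 + q ^ (2 * J)) * (q ^ m\<^sup>2 * p (J - m) * v m)"
        unfolding d by (simp add: power_add algebra_simps mult_2 mult_2_right)
    qed
    finally show ?thesis .
  qed
  then show "q ^ Suc j * g u (Suc j) + g v j = (1 + q ^ (2 * Suc j)) * g v (Suc j)"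
    by (simp add: J_def)
qed

text \<open>Splitting \<open>1 = (1 - q ^ (Suc j - m)) + q ^ (Suc j - m)\<close> in each weight, the
  first part lowers the level and the second combines with \<open>q ^ m\<close> to the constant
  \<open>q ^ Suc j\<close>. This serves the three-term relation centred at row 1.\<close>

lemma bailey_step_boundary:
  fixes q :: "'a::comm_ring_1" and h p :: "nat \<Rightarrow> 'a"
  assumes p: "\<And>d. p d = p (Suc d) * (1 - q ^ Suc d)"
  defines "g f j \<equiv> (\<Sum>m\<le>j. q ^ (m\<^sup>2) * p (j - m) * f m)"
  shows "g (\<lambda>m. q ^ m * h m) (Suc j) = g (\<lambda>m. q ^ m * h m) j + q ^ Suc j * g h (Suc j)"
proof -
  have "g (\<lambda>m. q ^ m * h m) j
      = (\<Sum>m\<le>Suc j. q ^ m\<^sup>2 * ((1 - q ^ (Suc j - m)) * p (Suc j - m)) * (q ^ m * h m))"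
    unfolding g_def sum.atMost_Suc
    by simp (intro sum.cong refl, subst p, simp add: Suc_diff_le mult_ac)
  moreover have "q ^ Suc j * g h (Suc j) = (\<Sum>m\<le>Suc j. q ^ m\<^sup>2 * (q ^ (Suc j - m) * p (Suc j - m)) * (q ^ m * h m))"
    unfolding g_def sum_distrib_left
  proof (intro sum.cong refl)
    fix m assume "m \<in> {..Suc j}"
    then have "q ^ Suc j = q ^ (Suc j - m) * q ^ m" by (simp flip: power_add del: power_Suc)
    then show "q ^ Suc j * (q ^ m\<^sup>2 * p (Suc j - m) * h m) = q ^ m\<^sup>2 * (q ^ (Suc j - m) * p (Suc j - m)) * (q ^ m * h m)"
      by (simp add: mult_ac)
  qed
  ultimately show ?thesis
    unfolding g_def by (simp add: algebra_simps flip: sum.distrib del: sum.atMost_Suc)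
qed

section \<open>Inverse q-Pochhammer symbols and the iterated transform\<close>

definition inv_qp :: "nat \<Rightarrow> rat fps" where
  "inv_qp n = inverse (qpoch fps_X fps_X n)"

definition inv_qp2 :: "nat \<Rightarrow> rat fps" where
  "inv_qp2 n = inverse (qpoch (fps_X\<^sup>2) (fps_X\<^sup>2) n)"

lemma qpoch_Suc: "qpoch a q (Suc n) = qpoch a q n * (1 - a * q ^ n)"
  by (simp add: qpoch_def)

lemma inverse_fps_mult_cancel:
  fixes a b :: "'a::field fps"
  assumes "fps_nth b 0 \<noteq> 0"
  shows "inverse (a * b) * b = inverse a"
  by (simp add: fps_inverse_mult assms mult.assoc inverse_mult_eq_1)

lemma inv_qp_Suc: "inv_qp n = inv_qp (Suc n) * (1 - fps_X ^ Suc n)"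
  unfolding inv_qp_def qpoch_Suc power_Suc by (rule inverse_fps_mult_cancel[symmetric]) simp

lemma inv_qp2_Suc: "inv_qp2 n = inv_qp2 (Suc n) * (1 - fps_X ^ (2 * Suc n))"
proof -
  have "(fps_X :: rat fps) ^ (2 * Suc n) = fps_X\<^sup>2 * (fps_X\<^sup>2) ^ n"
    by (simp add: power_mult power2_eq_square)
  then show ?thesis
    unfolding inv_qp2_def qpoch_Suc
    by (simp only: inverse_fps_mult_cancel[symmetric] fps_sub_nth) (rule inverse_fps_mult_cancel[symmetric], simp)
qed

lemma inv_qp_0 [simp]: "inv_qp 0 = 1" "inv_qp2 0 = 1"
  by (simp_all add: inv_qp_def inv_qp2_def qpoch_def)

text \<open>The first index is one less than the \<open>l\<close> of the theorem; the second one is the row.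
  Up to the factor \<open>q ^ j\<^sup>2\<close>, \<open>bailey (l - 1) r j\<close> is the part with \<open>N\<^sub>1 = j\<close> of the multisum
  with linear form \<open>N\<^sub>r\<^sub>+\<^sub>1 + \<dots> + N\<^sub>l\<close>.\<close>

fun bailey :: "nat \<Rightarrow> nat \<Rightarrow> nat \<Rightarrow> rat fps" where
  "bailey 0 0 j = fps_X ^ j * inv_qp2 j"
| "bailey 0 (Suc r) j = inv_qp2 j"
| "bailey (Suc l) (Suc r) j = (\<Sum>m\<le>j. fps_X ^ (m\<^sup>2) * inv_qp (j - m) * bailey l r m)"
| "bailey (Suc l) 0 j = fps_X ^ j * (\<Sum>m\<le>j. fps_X ^ (m\<^sup>2) * inv_qp (j - m) * bailey l 0 m)"

lemma bailey_row_0: "bailey l 0 j = fps_X ^ j * bailey l 1 j"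
  by (cases l) auto

text \<open>Raising both indices by 1 carries the relation along by
  \<open>bailey_step_tridiagonal\<close>; only \<open>r = 0\<close> needs the boundary step. For
  \<open>r = l\<close> the row above row \<open>l + 1\<close> is replaced by its mirror image
  \<open>l\<close>. The first conjunct is the instance \<open>j = -1\<close>, which the induction
  needs as \<open>rec0\<close>.\<close>

lemma bailey_tridiagonal:
  assumes "r \<le> l"
  shows "bailey l r 0 + bailey l (if r = l then r else r + 2) 0 = 2 * bailey l (Suc r) 0
    \<and> (\<forall>j. fps_X ^ Suc j * (bailey l r (Suc j) + bailey l (if r = l then r else r + 2) (Suc j)) + bailey l (Suc r) j
       = (1 + fps_X ^ (2 * Suc j)) * bailey l (Suc r) (Suc j))"
  using assms
proof (induction l arbitrary: r)
  case 0
  \<comment> \<open>The reflection doubles the lower neighbour, and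
    \<open>(1 - x) + 2 * x = 1 + x\<close> for \<open>x = q ^ (2 * Suc j)\<close>. This is why the
    last factor has base \<open>q\<^sup>2\<close>.\<close>
  have "fps_X ^ Suc j * (fps_X ^ Suc j * inv_qp2 (Suc j) + fps_X ^ Suc j * inv_qp2 (Suc j)) + inv_qp2 j
      = (1 + fps_X ^ (2 * Suc j)) * inv_qp2 (Suc j)" for j
    unfolding inv_qp2_Suc[of j] mult_2 power_add by (simp only: algebra_simps mult_1_right)
  then show ?case using 0 by (simp del: power_Suc mult_Suc_right)
next
  case (Suc l)
  show ?case
  proof (cases r)
    case 0
    have "bailey (Suc l) 1 k = (\<Sum>m\<le>k. fps_X ^ (m\<^sup>2) * inv_qp (k - m) * (fps_X ^ m * bailey l 1 m))"
      "bailey (Suc l) 2 k = (\<Sum>m\<le>k. fps_X ^ (m\<^sup>2) * inv_qp (k - m) * bailey l 1 m)" for k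
      using bailey_row_0[of l] by (simp_all add: numeral_2_eq_2)
    note sums = this
    have "bailey (Suc l) 1 (Suc j) = bailey (Suc l) 1 j + fps_X ^ Suc j * bailey (Suc l) 2 (Suc j)" for j
      unfolding sums by (rule bailey_step_boundary) (rule inv_qp_Suc)
    \<comment> \<open>With \<open>x = q ^ Suc j\<close>, row 0 is \<open>x * c\<close>, and adding
      \<open>x * x * c\<close> to the boundary relation \<open>c = a + x * b\<close> gives the
      three-term relation.\<close>
    moreover have "x * (x * c + b) + a = (1 + x * x) * c" if "c = a + x * b" for x a b c :: "rat fps"
      using that by (simp add: algebra_simps)
    ultimately have "fps_X ^ Suc j * (fps_X ^ Suc j * bailey (Suc l) 1 (Suc j) + bailey (Suc l) 2 (Suc j))
        + bailey (Suc l) 1 j = (1 + fps_X ^ (2 * Suc j)) * bailey (Suc l) 1 (Suc j)" for j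
      unfolding mult_2 power_add by blast
    moreover have "bailey (Suc l) 0 0 + bailey (Suc l) 2 0 = 2 * bailey (Suc l) 1 0"
      using sums[of 0] bailey_row_0[of "Suc l" 0] by (simp del: bailey.simps)
    ultimately show ?thesis
      unfolding 0 by (simp add: bailey_row_0[of "Suc l"] flip: numeral_2_eq_2 del: bailey.simps power_Suc mult_Suc_right)
  next
    case r: (Suc r')
    define r2 where "r2 = (if r' = l then r' else r' + 2)"
    have r2: "(if r = Suc l then r else r + 2) = Suc r2" by (simp add: r2_def r)
    have IH: "bailey l r' 0 + bailey l r2 0 = 2 * bailey l (Suc r') 0"
      "\<And>j. fps_X ^ Suc j * (bailey l r' (Suc j) + bailey l r2 (Suc j)) + bailey l (Suc r') j
       = (1 + fps_X ^ (2 * Suc j)) * bailey l (Suc r') (Suc j)"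
      using Suc.IH[of r'] Suc.prems unfolding r2_def r by auto
    have sum2: "bailey (Suc l) r j + bailey (Suc l) (Suc r2) j =
        (\<Sum>m\<le>j. fps_X ^ (m\<^sup>2) * inv_qp (j - m) * (bailey l r' m + bailey l r2 m))" for j
      by (simp add: r algebra_simps flip: sum.distrib)
    show ?thesis unfolding r2 sum2
      using bailey_step_tridiagonal[where u = "\<lambda>m. bailey l r' m + bailey l r2 m" and v = "bailey l (Suc r')", OF inv_qp_Suc IH]
      by (simp add: r del: sum.atMost_Suc)
  qed
qed

section \<open>Inverting the three-term relation on all rows\<close>

text \<open>The kernel \<open>x ^ \<bar>r - s\<bar>\<close> inverts the tridiagonal operator, up to the factor \<open>1 - x\<^sup>2\<close>.\<close>

lemma green_kernel:
  fixes x :: "'a::comm_ring_1" and a b :: "nat \<Rightarrow> 'a"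
  assumes tri: "\<And>s. 1 \<le> s \<Longrightarrow> s < n \<Longrightarrow> (1 + x\<^sup>2) * a s = x * (a (s - 1) + a (s + 1)) + b s"
    and bd: "a 0 = x * a 1" "a n = x * a (n - 1)" and r: "r < n"
  shows "(\<Sum>s = 1..<n. x ^ ((r - s) + (s - r)) * b s) = (1 - x\<^sup>2) * a r"
proof -
  \<comment> \<open>The sum on each side of \<open>r\<close> is evaluated by induction from its own
    end, where the empty sum is the boundary condition \<open>bd\<close>.\<close>
  have left: "(\<Sum>s = 1..r. x ^ (r - s) * b s) = a r - x * a (r + 1)" if "r < n" for r
    using that
  proof (induction r)
    case 0 then show ?case using bd by simp
  next
    case (Suc r)
    have "(\<Sum>s = 1..Suc r. x ^ (Suc r - s) * b s) = x * (\<Sum>s = 1..r. x ^ (r - s) * b s) + b (Suc r)"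
      by (simp add: sum_distrib_left Suc_diff_le mult_ac)
    also have "\<dots> = x * (a r - x * a (r + 1)) + b (Suc r)" using Suc by simp
    also have "\<dots> = a (Suc r) - x * a (Suc r + 1)"
      using tri[of "Suc r"] Suc.prems by (simp add: algebra_simps power2_eq_square)
    finally show ?case .
  qed
  have right: "(\<Sum>s = n - k..<n. x ^ (s - (n - k)) * b s) = a (n - k) - x * a (n - k - 1)" if "k < n" for k
    using that
  proof (induction k)
    case 0 then show ?case using bd by simp
  next
    case (Suc k)
    define t where "t = n - Suc k"
    have t: "n - k = Suc t" "1 \<le> t" "t < n" using Suc.prems by (auto simp: t_def)
    have "(\<Sum>s = t..<n. x ^ (s - t) * b s) = b t + x * (\<Sum>s = Suc t..<n. x ^ (s - Suc t) * b s)"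
      using t by (subst sum.atLeast_Suc_lessThan) (auto simp: sum_distrib_left mult.assoc[symmetric] Suc_diff_Suc Suc_le_eq
        simp flip: power_Suc intro!: sum.cong)
    also have "\<dots> = b t + x * (a (Suc t) - x * a t)" using Suc t by simp
    also have "\<dots> = a t - x * a (t - 1)"
      using tri[of t] t by (simp add: algebra_simps power2_eq_square)
    finally show ?case by (simp add: t_def)
  qed
  have "{1..<n} = {1..r} \<union> {Suc r..<n}" "{1..r} \<inter> {Suc r..<n} = {}" using r by auto
  then have "(\<Sum>s = 1..<n. x ^ ((r - s) + (s - r)) * b s) =
     (\<Sum>s = 1..r. x ^ ((r - s) + (s - r)) * b s) + (\<Sum>s = Suc r..<n. x ^ ((r - s) + (s - r)) * b s)"
    by (simp add: sum.union_disjoint)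
  also have "(\<Sum>s = 1..r. x ^ ((r - s) + (s - r)) * b s) = (\<Sum>s = 1..r. x ^ (r - s) * b s)"
    by (intro sum.cong) auto
  also have "(\<Sum>s = Suc r..<n. x ^ ((r - s) + (s - r)) * b s) = x * (\<Sum>s = Suc r..<n. x ^ (s - Suc r) * b s)"
    unfolding sum_distrib_left 
    by (intro sum.cong refl) (auto simp: mult.assoc[symmetric] Suc_diff_Suc simp flip: power_Suc)
  also have "(\<Sum>s = Suc r..<n. x ^ (s - Suc r) * b s) = a (Suc r) - x * a r"
    using right[of "n - Suc r"] r by simp
  finally show ?thesis using left[OF r] by (simp add: algebra_simps power2_eq_square)
qed


definition gap :: "nat \<Rightarrow> nat \<Rightarrow> nat" where
  "gap r s = (r - s) + (s - r)"

text \<open>The rows \<open>1, ..., 2 * l - 1\<close> that can carry parts are symmetric about row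
  \<open>l\<close>, so rows above \<open>l\<close> get the series of their mirror images. Row
  \<open>2 * l\<close>, the mirror image of row 0, gives the second boundary value.\<close>

definition reflected_bailey :: "nat \<Rightarrow> nat \<Rightarrow> nat \<Rightarrow> rat fps" where
  "reflected_bailey l r j = bailey (l - 1) (if r \<le> l then r else 2 * l - r) j"

lemma reflected_bailey_tridiagonal:
  assumes s: "1 \<le> s" "s < 2 * l"
  shows "(1 + (fps_X ^ Suc j)\<^sup>2) * reflected_bailey l s (Suc j) =
    fps_X ^ Suc j * (reflected_bailey l (s - 1) (Suc j) + reflected_bailey l (s + 1) (Suc j))
    + reflected_bailey l s j"
proof -
  have sq: "((fps_X :: rat fps) ^ Suc j)\<^sup>2 = fps_X ^ (2 * Suc j)"
    by (simp only: mult_2 power_add power2_eq_square)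
  note tri = conjunct2[OF bailey_tridiagonal, rule_format, of _ "l - 1" j, symmetric]
  show ?thesis
  proof (cases "s \<le> l")
    case True
    obtain r where r: "s = Suc r" using s by (cases s) auto
    have "reflected_bailey l (s + 1) (Suc j) = bailey (l - 1) (if r = l - 1 then r else r + 2) (Suc j)"
      using True by (auto simp: reflected_bailey_def r numeral_2_eq_2)
    then show ?thesis
      using tri[of r] True by (simp add: sq reflected_bailey_def r del: power_Suc mult_Suc_right)
  next
    case False
    define r where "r = 2 * l - s - 1"
    have "r < l - 1" "2 * l - s = Suc r" "2 * l - (s + 1) = r" using s False by (auto simp: r_def)
    moreover have "reflected_bailey l (s - 1) k = bailey (l - 1) (r + 2) k" for k
    proof (cases "s - 1 = l")
      case True
      then have "r + 2 = l" using s by (simp add: r_def)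
      with True show ?thesis by (simp add: reflected_bailey_def)
    next
      case neq: False
      then have "2 * l - (s - 1) = r + 2" using s False by (simp add: r_def)
      then show ?thesis using neq False by (simp add: reflected_bailey_def)
    qed
    ultimately show ?thesis
      using tri[of r] False by (simp add: sq reflected_bailey_def add.commute del: power_Suc mult_Suc_right)
  qed
qed

lemma reflected_bailey_kernel:
  assumes "l \<ge> 1" "r < 2 * l"
  shows "(\<Sum>s = 1..<2 * l. fps_X ^ (Suc j * gap r s) * reflected_bailey l s j)
    = (1 - fps_X ^ (2 * Suc j)) * reflected_bailey l r (Suc j)"
proof -
  have "(\<Sum>s = 1..<2 * l. (fps_X ^ Suc j) ^ ((r - s) + (s - r)) * reflected_bailey l s j)
    = (1 - (fps_X ^ Suc j)\<^sup>2) * reflected_bailey l r (Suc j)"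
  proof (rule green_kernel)
    fix s assume "1 \<le> s" "s < 2 * l"
    then show "(1 + (fps_X ^ Suc j)\<^sup>2) * reflected_bailey l s (Suc j) =
      fps_X ^ Suc j * (reflected_bailey l (s - 1) (Suc j) + reflected_bailey l (s + 1) (Suc j))
      + reflected_bailey l s j"
      by (rule reflected_bailey_tridiagonal)
  next
    show "reflected_bailey l 0 (Suc j) = fps_X ^ Suc j * reflected_bailey l 1 (Suc j)"
      using assms(1) bailey_row_0[of "l - 1" "Suc j"]
      by (simp add: reflected_bailey_def del: bailey.simps power_Suc)
    \<comment> \<open>Row \<open>2 * l - 1\<close> is the mirror image of row 1; for
      \<open>l = 1\<close> it is the middle row and is not reflected.\<close>
    have "2 * l - (2 * l - 1) = 1" "2 * l - 1 \<le> l \<Longrightarrow> l = 1" using assms(1) by auto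
    then show "reflected_bailey l (2 * l) (Suc j) = fps_X ^ Suc j * reflected_bailey l (2 * l - 1) (Suc j)"
      using assms(1) bailey_row_0[of "l - 1" "Suc j"] by (auto simp: reflected_bailey_def simp del: bailey.simps power_Suc)
  qed fact
  moreover have "((fps_X :: rat fps) ^ Suc j)\<^sup>2 = fps_X ^ (2 * Suc j)"
    by (simp only: mult_2 power_add power2_eq_square)
  ultimately show ?thesis
    by (simp add: gap_def power_mult del: power_Suc mult_Suc mult_Suc_right)
qed

lemma bailey_0: "bailey l r 0 = 1"
  by (induction l r "0::nat" rule: bailey.induct) auto

section \<open>Chains and their generating functions\<close>

text \<open>A chain lists its parts by increasing column: the entry \<open>(s, e)\<close> after a part in row \<open>r\<close>
  and column \<open>x\<close> is the part in row \<open>s\<close> and column \<open>x + gap r s + 2 + 2 e\<close>.  The function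
  \<open>chain_weight\<close> leaves out the contributions of the starting column and of the summands 2.\<close>

definition chains :: "nat \<Rightarrow> nat \<Rightarrow> (nat \<times> nat) list set" where
  "chains l j = {t. length t = j \<and> fst ` set t \<subseteq> {1..<2 * l}}"

fun chain_weight :: "nat \<Rightarrow> (nat \<times> nat) list \<Rightarrow> nat" where
  "chain_weight r [] = 0"
| "chain_weight r ((s, e) # t) = Suc (length t) * (gap r s + 2 * e) + chain_weight s t"

definition chain_series :: "nat \<Rightarrow> nat \<Rightarrow> nat \<Rightarrow> rat fps" where
  "chain_series l r j = Abs_fps (\<lambda>n. of_nat (card {t \<in> chains l j. chain_weight r t = n}))"

lemma chain_weight_ge: "p \<in> set t \<Longrightarrow> snd p \<le> chain_weight r t"
  by (induction r t rule: chain_weight.induct) (fastforce simp: trans_le_add2)+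

lemma finite_chains_weight: "finite {t \<in> chains l j. chain_weight r t = n}"
proof (rule finite_subset)
  show "{t \<in> chains l j. chain_weight r t = n} \<subseteq> {t. set t \<subseteq> {1..<2 * l} \<times> {..n} \<and> length t = j}"
    using chain_weight_ge by (fastforce simp: chains_def)
qed (intro finite_lists_length_eq finite_SigmaI; simp)

text \<open>If the first entry has \<open>e = 0\<close>, dropping it leaves a chain of
  \<open>j\<close> parts from row \<open>s\<close>. If \<open>e > 0\<close>, lowering
  \<open>e\<close> by 1 moves all \<open>Suc j\<close> parts two columns to the left, which accounts
  for \<open>q ^ (2 * Suc j)\<close>.\<close>

lemma chain_series_Suc:
  "chain_series l r (Suc j) = (\<Sum>s = 1..<2 * l. fps_X ^ (Suc j * gap r s) * chain_series l s j)
     + fps_X ^ (2 * Suc j) * chain_series l r (Suc j)"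
proof (rule fps_ext)
  fix n
  define W where "W i k m = {t \<in> chains l k. m + chain_weight i t = n}" for i k m
  have W: "W i k m = (if n < m then {} else {t \<in> chains l k. chain_weight i t = n - m})" for i k m
    by (auto simp: W_def)
  have fin: "finite (W i k m)" for i k m
    unfolding W using finite_chains_weight by auto
  have coeff: "fps_nth (fps_X ^ m * chain_series l i k) n = of_nat (card (W i k m))" for i k m
    by (auto simp: W chain_series_def fps_X_power_mult_nth)
  define low where "low s = (#) (s, 0::nat) ` W s j (Suc j * gap r s)" for s
  define raise where "raise t = (fst (hd t), Suc (snd (hd t))) # tl t" for t :: "(nat \<times> nat) list"
  define high where "high = raise ` W r (Suc j) (2 * Suc j)"
  have "W r (Suc j) 0 = (\<Union>s\<in>{1..<2 * l}. low s) \<union> high"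
  proof (intro equalityI subsetI)
    fix t assume t: "t \<in> W r (Suc j) 0"
    then obtain s e u where u: "t = (s, e) # u" "length u = j"
      by (auto simp: W_def chains_def length_Suc_conv)
    show "t \<in> (\<Union>s\<in>{1..<2 * l}. low s) \<union> high"
    proof (cases e)
      case 0
      then show ?thesis using t u by (auto simp: low_def W_def chains_def)
    next
      case (Suc d)
      then have "(s, d) # u \<in> W r (Suc j) (2 * Suc j)" using t u 
        by (auto simp: W_def chains_def algebra_simps)
      moreover have "t = raise ((s, d) # u)" by (simp add: raise_def u Suc)
      ultimately show ?thesis by (auto simp: high_def)
    qed
  next
    fix t assume "t \<in> (\<Union>s\<in>{1..<2 * l}. low s) \<union> high"
    then show "t \<in> W r (Suc j) 0"
    proof
      assume "t \<in> high"
      then obtain v where v: "v \<in> W r (Suc j) (2 * Suc j)" "t = raise v" by (auto simp: high_def)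
      then obtain s e u where u: "v = (s, e) # u" "length u = j"
        by (auto simp: W_def chains_def length_Suc_conv)
      show ?thesis using v u by (auto simp: W_def chains_def raise_def algebra_simps)
    qed (fastforce simp: low_def W_def chains_def)
  qed
  moreover have "card ((\<Union>s\<in>{1..<2 * l}. low s) \<union> high) = card (\<Union>s\<in>{1..<2 * l}. low s) + card high"
    by (rule card_Un_disjoint) (auto simp: low_def high_def fin raise_def)
  moreover have "card (\<Union>s\<in>{1..<2 * l}. low s) = (\<Sum>s = 1..<2 * l. card (low s))"
    by (rule card_UN_disjoint) (auto simp: low_def fin)
  moreover have "card (low s) = card (W s j (Suc j * gap r s))" for s
    unfolding low_def by (rule card_image) (auto simp: inj_on_def)
  moreover have "card high = card (W r (Suc j) (2 * Suc j))"
    unfolding high_def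
  proof (rule card_image, rule inj_onI)
    fix t u assume *: "t \<in> W r (Suc j) (2 * Suc j)" "u \<in> W r (Suc j) (2 * Suc j)" "raise t = raise u"
    then have "t \<noteq> []" "u \<noteq> []" by (auto simp: W_def chains_def)
    with *(3) show "t = u" by (cases t; cases u) (auto simp: raise_def prod_eq_iff)
  qed
  ultimately have "card (W r (Suc j) 0) = (\<Sum>s = 1..<2 * l. card (W s j (Suc j * gap r s))) + card (W r (Suc j) (2 * Suc j))"
    by simp
  moreover have "fps_nth (chain_series l r (Suc j)) n = of_nat (card (W r (Suc j) 0))"
    using coeff[of 0 r "Suc j"] by simp
  ultimately show "fps_nth (chain_series l r (Suc j)) n = fps_nth ((\<Sum>s = 1..<2 * l. fps_X ^ (Suc j * gap r s) * chain_series l s j)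
     + fps_X ^ (2 * Suc j) * chain_series l r (Suc j)) n"
    by (simp add: coeff fps_sum_nth del: power_Suc mult_Suc mult_Suc_right)
qed

text \<open>Both sides are 1 for \<open>j = 0\<close> and satisfy the same recurrence in
  \<open>j\<close>, whose factor \<open>1 - q ^ (2 * Suc j)\<close> can be cancelled.\<close>

lemma chain_series_eq_reflected_bailey:
  assumes "l \<ge> 1" "r < 2 * l"
  shows "chain_series l r j = reflected_bailey l r j"
  using assms(2)
proof (induction j arbitrary: r)
  case 0
  have "{t \<in> chains l 0. chain_weight r t = n} = (if n = 0 then {[]} else {})" for n
    by (auto simp: chains_def)
  then show ?case
    by (simp add: chain_series_def reflected_bailey_def bailey_0 fps_eq_iff)
next
  case (Suc j)
  have "(1 - fps_X ^ (2 * Suc j)) * chain_series l r (Suc j)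
      = (\<Sum>s = 1..<2 * l. fps_X ^ (Suc j * gap r s) * chain_series l s j)"
    using chain_series_Suc[of l r j] by (simp add: left_diff_distrib diff_eq_eq del: power_Suc mult_Suc mult_Suc_right)
  also have "\<dots> = (\<Sum>s = 1..<2 * l. fps_X ^ (Suc j * gap r s) * reflected_bailey l s j)"
    by (intro sum.cong) (auto simp: Suc.IH)
  also have "\<dots> = (1 - fps_X ^ (2 * Suc j)) * reflected_bailey l r (Suc j)"
    using assms(1) Suc.prems by (rule reflected_bailey_kernel)
  finally have "(1 - fps_X ^ (2 * Suc j)) * chain_series l r (Suc j)
      = (1 - fps_X ^ (2 * Suc j)) * reflected_bailey l r (Suc j)" .
  moreover have "fps_nth (1 - fps_X ^ (2 * Suc j) :: rat fps) 0 = 1" by simp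
  then have "(1 - fps_X ^ (2 * Suc j) :: rat fps) \<noteq> 0" by (metis fps_zero_nth zero_neq_one)
  ultimately show ?case by (metis mult_left_cancel)
qed


section \<open>Separated sets of cells as chains\<close>

text \<open>For cells of the diagram this means that no downward path meets both.\<close>

definition separated :: "nat \<times> int \<Rightarrow> nat \<times> int \<Rightarrow> bool" where
  "separated p p' \<longleftrightarrow> \<bar>snd p - snd p'\<bar> > int (gap (fst p) (fst p'))"

text \<open>If \<open>(r, x)\<close> is the cell of the initial condition, these are the supports of
  the arrays. A general \<open>(r, x)\<close> lets an induction restart at the first part.\<close>

definition configs :: "nat \<Rightarrow> nat \<Rightarrow> int \<Rightarrow> nat \<Rightarrow> (nat \<times> int) set set" where
  "configs l r x j = {S. finite S \<and> card S = j \<and>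
     (\<forall>(s, y) \<in> S. 1 \<le> s \<and> s < 2 * l \<and> even (y - int s) \<and> y - x > int (gap r s)) \<and>
     pairwise separated S}"

text \<open>By parity \<open>y - x - gap r s\<close> is even; being positive, it is
  \<open>2 + 2 * e\<close> for exactly one natural \<open>e\<close>.\<close>

fun cells :: "nat \<Rightarrow> int \<Rightarrow> (nat \<times> nat) list \<Rightarrow> (nat \<times> int) set" where
  "cells r x [] = {}"
| "cells r x ((s, e) # t) =
     (let y = x + int (gap r s + 2 + 2 * e) in insert (s, y) (cells s y t))"

lemma gap_triangle: "gap r t \<le> gap r s + gap s t"
  by (simp add: gap_def)

lemma gap_commute: "gap r s = gap s r"
  by (simp add: gap_def)

lemma even_gap: "even (int (gap r s) + int r + int s)"
  by (cases "r \<le> s") (auto simp: gap_def)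

text \<open>Each step of a chain exceeds the gap of its two rows, and by the triangle inequality for
  \<open>gap\<close> this adds up, so conditions on consecutive cells control all pairs.\<close>

lemma cells_gap: "(s, y) \<in> cells r x t \<Longrightarrow> y - x > int (gap r s)"
proof (induction r x t rule: cells.induct)
  case (2 r x s' e t)
  then show ?case using gap_triangle[of r s s'] by (force simp: Let_def)
qed auto

lemma cells_in_configs:
  "t \<in> chains l j \<Longrightarrow> even (x - int r) \<Longrightarrow> cells r x t \<in> configs l r x j"
proof (induction t arbitrary: j r x)
  case Nil
  then show ?case by (auto simp: chains_def configs_def)
next
  case (Cons a t)
  obtain s e where a: "a = (s, e)" by (cases a)
  obtain k where j: "j = Suc k" using Cons.prems by (auto simp: chains_def)
  define y where "y = x + int (gap r s + 2 + 2 * e)"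
  have s: "t \<in> chains l k" "1 \<le> s" "s < 2 * l" using Cons.prems by (auto simp: chains_def j a)
  have par: "even (y - int s)"
    using Cons.prems(2) even_gap[of r s] unfolding y_def by simp presburger
  have tl: "cells s y t \<in> configs l s y k" by (rule Cons.IH) fact+
  have beyond: "y' - y > int (gap s s')" if "(s', y') \<in> cells s y t" for s' y'
    using cells_gap that .
  have "(s, y) \<notin> cells s y t" using beyond[of s y] by auto
  moreover have "y' - x > int (gap r s')" if "(s', y') \<in> cells s y t" for s' y'
    using beyond[OF that] gap_triangle[of r s' s] by (simp add: y_def)
  moreover have "separated (s, y) p \<and> separated p (s, y)" if "p \<in> cells s y t" for p
    using that beyond[of "fst p" "snd p"] by (auto simp: separated_def gap_commute[of s])
  ultimately show ?case
    using tl s par unfolding configs_def j a cells.simps Let_def y_def[symmetric]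
    by (auto simp: pairwise_insert y_def)
qed

lemma inj_on_cells: "inj_on (cells r x) {t. length t = j}"
proof (rule inj_onI)
  fix t u assume "t \<in> {t. length t = j}" "u \<in> {t. length t = j}" "cells r x t = cells r x u"
  then have "length t = length u" "cells r x t = cells r x u" by auto
  then show "t = u"
  proof (induction t u arbitrary: r x rule: list_induct2)
    case (Cons a t b u)
    obtain s e s' e' where ab: "a = (s, e)" "b = (s', e')" by (cases a, cases b)
    define y where "y = x + int (gap r s + 2 + 2 * e)"
    define y' where "y' = x + int (gap r s' + 2 + 2 * e')"
    have eq: "insert (s, y) (cells s y t) = insert (s', y') (cells s' y' u)"
      using Cons.prems by (simp add: ab Let_def y_def y'_def)
    \<comment> \<open>Otherwise each of the two first cells would lie to the right of the
      other.\<close>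
    have head: "(s, y) = (s', y')"
    proof (rule ccontr)
      assume "(s, y) \<noteq> (s', y')"
      with eq have "(s, y) \<in> cells s' y' u" "(s', y') \<in> cells s y t" by auto
      from this[THEN cells_gap] show False by simp
    qed
    have "(s, y) \<notin> cells s y t" "(s, y) \<notin> cells s y u"
      using cells_gap[of s y s y t] cells_gap[of s y s y u] by auto
    with eq head have "cells s y t = cells s y u" by (metis Pair_inject insert_ident)
    then show ?case using Cons.IH head by (auto simp: ab y_def y'_def)
  qed simp
qed

text \<open>The cell of least column comes first: the others are separated from it and lie to its
  right, so they form a configuration that starts there.\<close>

lemma configs_obtain_chain:
  "S \<in> configs l r x j \<Longrightarrow> even (x - int r) \<Longrightarrow> \<exists>t\<in>chains l j. S = cells r x t"
proof (induction j arbitrary: S r x)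
  case 0
  then show ?case by (auto simp: configs_def chains_def)
next
  case (Suc j)
  then have fin: "finite S" "S \<noteq> {}" by (auto simp: configs_def)
  then obtain p where p: "p \<in> S" "\<And>p'. p' \<in> S \<Longrightarrow> snd p \<le> snd p'"
    using arg_min_if_finite[OF fin, of snd] by (metis not_le_imp_less)
  obtain s y where sy: "p = (s, y)" by (cases p)
  have s: "1 \<le> s" "s < 2 * l" "even (y - int s)" "y - x > int (gap r s)"
    using Suc.prems p(1) by (auto simp: configs_def sy)
  have "even (y - x - int (gap r s))"
    using s(3) Suc.prems(2) even_gap[of r s] by presburger
  then obtain c where c: "y - x - int (gap r s) = 2 * c" by (elim evenE)
  define e where "e = nat (c - 1)"
  have e: "y = x + int (gap r s + 2 + 2 * e)" using c s(4) by (simp add: e_def)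
  have "y' - y > int (gap s s')" if "(s', y') \<in> S - {p}" for s' y'
  proof -
    have "separated p (s', y')" using that Suc.prems(1) p(1) by (auto simp: configs_def pairwise_def)
    then show ?thesis using p(2)[of "(s', y')"] that by (auto simp: separated_def sy)
  qed
  then have "S - {p} \<in> configs l s y j"
    using Suc.prems(1) p(1) fin by (auto simp: configs_def pairwise_def)
  then obtain t where t: "t \<in> chains l j" "S - {p} = cells s y t" using Suc.IH s(3) by blast
  then have "S = cells r x ((s, e) # t)" using p(1) by (auto simp: Let_def sy e)
  moreover have "(s, e) # t \<in> chains l (Suc j)" using t s by (auto simp: chains_def)
  ultimately show ?case by blast
qed

lemma bij_betw_cells:
  assumes "even (x - int r)"
  shows "bij_betw (cells r x) (chains l j) (configs l r x j)"
proof (rule bij_betw_imageI)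
  show "inj_on (cells r x) (chains l j)"
    using inj_on_cells[of r x j] by (rule inj_on_subset) (auto simp: chains_def)
  show "cells r x ` chains l j = configs l r x j"
    using cells_in_configs[OF _ assms] configs_obtain_chain[OF _ assms] by blast
qed

lemma finite_cells: "finite (cells r x t)"
  by (induction r x t rule: cells.induct) (auto simp: Let_def)

text \<open>The start column enters the column of every part once, and the summands 2 accumulate to
  \<open>2 + 4 + ... + 2 * length t\<close>.\<close>

lemma sum_cells:
  "(\<Sum>p\<in>cells r x t. snd p) = int (length t) * (x + int (length t) + 1) + int (chain_weight r t)"
proof (induction r x t rule: cells.induct)
  case (2 r x s e t)
  define y where "y = x + int (gap r s + 2 + 2 * e)"
  have "(s, y) \<notin> cells s y t" using cells_gap[of s y s y t] by auto
  then have "(\<Sum>p\<in>cells r x ((s, e) # t). snd p) = y + (\<Sum>p\<in>cells s y t. snd p)"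
    by (simp add: Let_def y_def finite_cells)
  also have "(\<Sum>p\<in>cells s y t. snd p) = int (length t) * (y + int (length t) + 1) + int (chain_weight s t)"
    using 2 by (simp add: y_def)
  finally show ?case by (simp add: y_def algebra_simps)
qed simp

section \<open>Admissible arrays as separated sets\<close>

definition start_cell :: "nat \<Rightarrow> nat \<times> int" where
  "start_cell i = (if i = 0 then (0, 0) else (2 * i - 1, -1))"

abbreviation unit_init :: "nat \<Rightarrow> nat \<Rightarrow> nat" where
  "unit_init i \<equiv> \<lambda>s. if s = i then 1 else 0"

lemma cell_value_unit_init:
  "cell_value (unit_init i) f r x = (if x \<ge> 1 then f (r, x) else of_bool ((r, x) = start_cell i))"
  by (auto simp: cell_value_def start_cell_def elim!: oddE)

lemma downward_path_lipschitz:
  assumes "downward_path l X" "r \<le> r'" "r' < 2 * l"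
  shows "\<bar>X r - X r'\<bar> \<le> int (r' - r)"
  using assms(2,3)
proof (induction r' rule: dec_induct)
  case (step n)
  have "\<bar>X (Suc n) - X n\<bar> = 1" using assms(1) step.prems by (force simp: downward_path_def)
  then show ?case using step by (simp add: Suc_diff_le)
qed simp

lemma downward_path_through_cell:
  assumes "even (x - int r)"
  shows "\<exists>X. downward_path l X \<and> X r = x"
  using assms by (intro exI[of _ "\<lambda>s. x + int s - int r"]) (auto simp: downward_path_def)

lemma downward_path_through_cells:
  assumes "even (x - int r)" "even (x' - int r')" "r < r'" "\<bar>x - x'\<bar> \<le> int (gap r r')"
  shows "\<exists>X. downward_path l X \<and> X r = x \<and> X r' = x'"
proof (intro exI conjI)
  \<comment> \<open>The lines of slope 1 through the first cell and of slope -1 through the second.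
    By \<open>assms(4)\<close> their minimum passes through both cells; equal parity prevents a step
    of size 0 where they cross.\<close>
  let ?X = "\<lambda>s. min (x + (int s - int r)) (x' + (int r' - int s))"
  show "?X r = x" "?X r' = x'" using assms(3,4) by (auto simp: gap_def)
  show "downward_path l ?X"
    unfolding downward_path_def
  proof (intro conjI allI impI)
    fix s :: nat
    have "even (x + (int s - int r) - int s)" "even (x' + (int r' - int s) - int s)"
      using assms(1,2) by presburger+
    then show "even (?X s - int s)" by (simp only: min_def split: if_split) simp
    assume "1 \<le> s \<and> s < 2 * l"
    then have "int (s - 1) = int s - 1" by auto
    moreover have "even ((x + (int s - int r)) - (x' + (int r' - int s)))"
      using assms(1,2) by presburger
    ultimately show "\<bar>?X s - ?X (s - 1)\<bar> = 1" unfolding min_def by presburger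
  qed
qed

text \<open>A path through two nonzero cells would have sum at least 2, while
  \<open>k = 1\<close>.\<close>

lemma admissible_separated:
  assumes "admissible l (unit_init i) f" "i \<le> l"
    and c: "even (x - int r)" "even (x' - int r')" "r < 2 * l" "r' < 2 * l"
    and v: "cell_value (unit_init i) f r x \<ge> 1" "cell_value (unit_init i) f r' x' \<ge> 1"
    and neq: "(r, x) \<noteq> (r', x')"
  shows "separated (r, x) (r', x')"
proof -
  let ?v = "cell_value (unit_init i) f"
  have *: False if ab: "a < b" "even (y - int a)" "even (y' - int b)" "b < 2 * l" "?v a y \<ge> 1" "?v b y' \<ge> 1"
    "\<bar>y - y'\<bar> \<le> int (gap a b)" for a b y y'
  proof -
    obtain X where X: "downward_path l X" "X a = y" "X b = y'"
      using downward_path_through_cells[OF ab(2,3,1,7)] by blast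
    have "(\<Sum>r\<in>{a, b}. ?v r (X r)) \<le> (\<Sum>r<2 * l. ?v r (X r))"
      using ab by (intro sum_mono2) auto
    also have "\<dots> \<le> (\<Sum>j\<le>l. unit_init i j)" using assms(1) X(1) by (simp only: admissible_def)
    finally show False using ab X assms(2) by simp
  qed
  show ?thesis
  proof (cases r r' rule: linorder_cases)
    case less
    then show ?thesis using *[of r r' x x'] c v by (force simp: separated_def)
  next
    case equal
    then show ?thesis using neq by (auto simp: separated_def gap_def)
  next
    case greater
    then show ?thesis using *[of r' r x' x] c v by (force simp: separated_def gap_commute abs_minus_commute)
  qed
qed

lemma admissible_le_1:
  assumes "admissible l (unit_init i) f" "i \<le> l" "(r, x) \<in> part_positions l"
  shows "f (r, x) \<le> 1"
proof -
  let ?v = "cell_value (unit_init i) f"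
  obtain X where X: "downward_path l X" "X r = x"
    using downward_path_through_cell[of x r] assms(3) by (auto simp: part_positions_def)
  have "(\<Sum>r\<in>{r}. ?v r (X r)) \<le> (\<Sum>r<2 * l. ?v r (X r))"
    using assms(3) by (intro sum_mono2) (auto simp: part_positions_def)
  also have "\<dots> \<le> (\<Sum>j\<le>l. unit_init i j)" using assms(1) X(1) by (simp only: admissible_def)
  finally show ?thesis using X assms(2,3) by (simp add: part_positions_def cell_value_def)
qed

definition indicator_array :: "(nat \<times> int) set \<Rightarrow> nat \<times> int \<Rightarrow> nat" where
  "indicator_array S p = of_bool (p \<in> S)"

lemma start_cell_props:
  assumes "i \<le> l" "l \<ge> 1"
  shows "even (snd (start_cell i) - int (fst (start_cell i)))" "fst (start_cell i) < 2 * l"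
    "snd (start_cell i) \<le> 0" "- 1 \<le> snd (start_cell i)"
  using assms by (auto simp: start_cell_def)

text \<open>The point is to exclude column 0: it could only follow column -1 with gap 0, in the odd
  row \<open>2 * i - 1\<close>, which has no cells in even columns.\<close>

lemma configs_part_positions:
  assumes "S \<in> configs l (fst (start_cell i)) (snd (start_cell i)) j" "i \<le> l" "l \<ge> 1"
  shows "S \<subseteq> part_positions l"
proof
  fix p assume p: "p \<in> S"
  obtain s y where sy: "p = (s, y)" by (cases p)
  have *: "1 \<le> s" "s < 2 * l" "even (y - int s)" "y - snd (start_cell i) > int (gap (fst (start_cell i)) s)"
    using assms(1) p by (auto simp: configs_def sy)
  then have "y \<noteq> 0" using even_gap[of "fst (start_cell i)" s]
    by (cases "i = 0") (auto simp: start_cell_def gap_def)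
  then show "p \<in> part_positions l"
    using * start_cell_props[OF assms(2,3)] by (auto simp: part_positions_def sy)
qed

text \<open>Pairwise separation, the start cell included, lets a path meet at most one nonzero cell,
  and all values are at most 1.\<close>

lemma admissible_indicator_array:
  assumes S: "S \<in> configs l (fst (start_cell i)) (snd (start_cell i)) j" and i: "i \<le> l" "l \<ge> 1"
  shows "admissible_ss l (unit_init i) (indicator_array S)"
  unfolding admissible_ss_def admissible_def
proof (intro conjI allI impI)
  have pos: "S \<subseteq> part_positions l" using configs_part_positions[OF assms] .
  have "{p. indicator_array S p \<noteq> 0} = S" by (auto simp: indicator_array_def)
  then show "colored_partition l (indicator_array S)"
    using S pos by (auto simp: colored_partition_def configs_def indicator_array_def)
  show "indicator_array S (0, x) = 0" for x
    using S by (auto simp: indicator_array_def configs_def)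
  fix X assume X: "downward_path l X"
  let ?v = "\<lambda>r. cell_value (unit_init i) (indicator_array S) r (X r)"
  have le1: "?v r \<le> 1" for r
    by (simp add: cell_value_unit_init indicator_array_def)
  have in_S: "(r, X r) \<in> insert (start_cell i) S" if "?v r \<noteq> 0" for r
    using that by (auto simp: cell_value_unit_init indicator_array_def split: if_splits)
  have sep: "separated p p'" if "p \<in> insert (start_cell i) S" "p' \<in> insert (start_cell i) S" "p \<noteq> p'" for p p'
  proof -
    have "separated (start_cell i) q \<and> separated q (start_cell i)" if "q \<in> S" for q
      using S that gap_commute[of "fst q"] by (cases q) (auto simp: configs_def separated_def)
    then show ?thesis using that S by (auto simp: configs_def pairwise_def)
  qed
  have unique: "?v r = 0 \<or> ?v r' = 0" if "r < r'" "r' < 2 * l" for r r'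
  proof (rule ccontr)
    assume "\<not> ?thesis"
    then have "separated (r, X r) (r', X r')" using that by (intro sep in_S) auto
    then show False using downward_path_lipschitz[OF X, of r r'] that by (auto simp: separated_def gap_def)
  qed
  have "(\<Sum>r<2 * l. ?v r) \<le> 1"
  proof (cases "\<exists>r<2 * l. ?v r \<noteq> 0")
    case True
    then obtain r where r: "r < 2 * l" "?v r \<noteq> 0" by blast
    have "?v r' = 0" if "r' < 2 * l" "r' \<noteq> r" for r'
      using unique[of r r'] unique[of r' r] that r by (meson linorder_neqE_nat)
    then have "(\<Sum>r<2 * l. ?v r) = (\<Sum>r\<in>{r}. ?v r)"
      using r by (intro sum.mono_neutral_right) auto
    then show ?thesis using le1[of r] by simp
  next
    case False
    then have "(\<Sum>r<2 * l. ?v r) = 0" by (intro sum.neutral) blast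
    then show ?thesis by simp
  qed
  then show "(\<Sum>r<2 * l. ?v r) \<le> (\<Sum>j\<le>l. unit_init i j)" using i by simp
qed

lemma admissible_support:
  assumes f: "admissible_ss l (unit_init i) f" and i: "i \<le> l" "l \<ge> 1"
  defines "S \<equiv> {p. f p \<noteq> 0}"
  shows "S \<in> configs l (fst (start_cell i)) (snd (start_cell i)) (card S)" "f = indicator_array S"
proof -
  have adm: "admissible l (unit_init i) f" using f by (simp add: admissible_ss_def)
  then have cp: "colored_partition l f" by (simp add: admissible_def)
  then have fin: "finite S" by (simp add: colored_partition_def S_def)
  have pos: "S \<subseteq> part_positions l"
    using cp by (metis (mono_tags, lifting) S_def colored_partition_def mem_Collect_eq subsetI)
  have v: "cell_value (unit_init i) f s y \<ge> 1" if "(s, y) \<in> S" for s y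
    using that pos by (auto simp: cell_value_unit_init S_def part_positions_def)
  have vs: "cell_value (unit_init i) f (fst (start_cell i)) (snd (start_cell i)) \<ge> 1"
    using start_cell_props[OF i] by (simp add: cell_value_unit_init)
  have posD: "s < 2 * l" "even (y - int s)" "y \<ge> 1" if "(s, y) \<in> S" for s y
    using that pos by (auto simp: part_positions_def)
  have "separated (s, y) (s', y')" if "(s, y) \<in> S" "(s', y') \<in> S" "(s, y) \<noteq> (s', y')" for s y s' y'
    using that posD v by (intro admissible_separated[OF adm i(1)]) auto
  then have "pairwise separated S" by (auto simp: pairwise_def)
  moreover have "1 \<le> s \<and> s < 2 * l \<and> even (y - int s) \<and> y - snd (start_cell i) > int (gap (fst (start_cell i)) s)"
    if p: "(s, y) \<in> S" for s y
  proof -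
    have sy: "s < 2 * l" "even (y - int s)" "y \<ge> 1" using posD[OF p] by auto
    have "s \<noteq> 0" using p f by (auto simp: S_def admissible_ss_def intro: ccontr)
    have "separated (fst (start_cell i), snd (start_cell i)) (s, y)"
      using sy v[OF p] vs start_cell_props[OF i] by (intro admissible_separated[OF adm i(1)]) auto
    then show ?thesis using sy \<open>s \<noteq> 0\<close> start_cell_props[OF i] by (auto simp: separated_def)
  qed
  ultimately show "S \<in> configs l (fst (start_cell i)) (snd (start_cell i)) (card S)"
    using fin by (auto simp: configs_def)
  show "f = indicator_array S"
  proof
    fix p
    show "f p = indicator_array S p"
      using admissible_le_1[OF adm i(1), of "fst p" "snd p"] pos
      by (cases "f p = 0") (force simp: indicator_array_def S_def)+
  qed
qed

text \<open>Arrays correspond to their supports, and these to chains. The constant part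
  \<open>j * (x + j + 1)\<close> of the weight in \<open>sum_cells\<close> is
  \<open>j\<^sup>2\<close> for start column -1 and \<open>j\<^sup>2 + j\<close> for start column 0,
  which is the case \<open>i = 0\<close>.\<close>

lemma F_ss_eq_card_chains:
  assumes "i \<le> l" "l \<ge> 1"
  shows "F_ss l i j n = card {t \<in> chains l j. j\<^sup>2 + (if i = 0 then j else 0) + chain_weight (fst (start_cell i)) t = n}"
proof -
  let ?r = "fst (start_cell i)" and ?x = "snd (start_cell i)"
  have supp: "{p. indicator_array S p \<noteq> 0} = S" for S by (auto simp: indicator_array_def)
  have num: "num_parts (indicator_array S) = card S" for S
    unfolding num_parts_def supp by (simp add: indicator_array_def)
  have wt: "weight (indicator_array S) = (\<Sum>p\<in>S. nat (snd p))" for S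
    unfolding weight_def supp by (intro sum.cong) (auto simp: indicator_array_def)
  have "F_ss l i j n = card (indicator_array ` {S \<in> configs l ?r ?x j. (\<Sum>p\<in>S. nat (snd p)) = n})"
    unfolding F_ss_def
  proof (intro arg_cong[of _ _ card] equalityI subsetI)
    fix f assume "f \<in> {f. admissible_ss l (unit_init i) f \<and> num_parts f = j \<and> weight f = n}"
    then have f: "admissible_ss l (unit_init i) f" "num_parts f = j" "weight f = n" by auto
    note S = admissible_support[OF f(1) assms]
    have "num_parts f = card {p. f p \<noteq> 0}" "weight f = (\<Sum>p\<in>{p. f p \<noteq> 0}. nat (snd p))"
      using S(2) num wt by metis+
    then show "f \<in> indicator_array ` {S \<in> configs l ?r ?x j. (\<Sum>p\<in>S. nat (snd p)) = n}"
      using S f by auto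
  next
    fix f assume "f \<in> indicator_array ` {S \<in> configs l ?r ?x j. (\<Sum>p\<in>S. nat (snd p)) = n}"
    then show "f \<in> {f. admissible_ss l (unit_init i) f \<and> num_parts f = j \<and> weight f = n}"
      using admissible_indicator_array[OF _ assms] by (auto simp: num wt) (auto simp: configs_def)
  qed
  also have "\<dots> = card {S \<in> configs l ?r ?x j. (\<Sum>p\<in>S. nat (snd p)) = n}"
    by (intro card_image inj_onI) (metis supp)
  also have "{S \<in> configs l ?r ?x j. (\<Sum>p\<in>S. nat (snd p)) = n}
      = cells ?r ?x ` {t \<in> chains l j. j\<^sup>2 + (if i = 0 then j else 0) + chain_weight ?r t = n}"
  proof -
    have "(\<Sum>p\<in>cells ?r ?x t. nat (snd p)) = j\<^sup>2 + (if i = 0 then j else 0) + chain_weight ?r t"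
      if t: "t \<in> chains l j" for t
    proof -
      have "cells ?r ?x t \<subseteq> part_positions l"
        using configs_part_positions cells_in_configs t assms start_cell_props(1)[OF assms] by blast
      then have "int (\<Sum>p\<in>cells ?r ?x t. nat (snd p)) = (\<Sum>p\<in>cells ?r ?x t. snd p)"
        by (auto simp: part_positions_def intro!: sum.cong)
      also have "\<dots> = int (j\<^sup>2 + (if i = 0 then j else 0) + chain_weight ?r t)"
        using t unfolding sum_cells
        by (auto simp: chains_def start_cell_def power2_eq_square algebra_simps)
      finally show ?thesis by linarith
    qed
    moreover have "configs l ?r ?x j = cells ?r ?x ` chains l j"
      using bij_betw_cells[OF start_cell_props(1)[OF assms]] by (simp add: bij_betw_def)
    ultimately show ?thesis by auto
  qed
  also have "card \<dots> = card {t \<in> chains l j. j\<^sup>2 + (if i = 0 then j else 0) + chain_weight ?r t = n}"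
    by (intro card_image inj_on_subset[OF inj_on_cells[of ?r ?x j]]) (auto simp: chains_def)
  finally show ?thesis .
qed

lemma P_ss_nth:
  assumes "i \<le> l" "l \<ge> 1"
  shows "fps_nth (P_ss l i) j
    = fps_X ^ (j\<^sup>2 + (if i = 0 then j else 0)) * reflected_bailey l (fst (start_cell i)) j"
proof (rule fps_ext)
  fix n
  define m where "m = j\<^sup>2 + (if i = 0 then j else 0)"
  have "{t \<in> chains l j. m + chain_weight r t = n}
    = (if n < m then {} else {t \<in> chains l j. chain_weight r t = n - m})" for r
    by auto
  then have "fps_nth (fps_nth (P_ss l i) j) n = fps_nth (fps_X ^ m * chain_series l (fst (start_cell i)) j) n"
    using F_ss_eq_card_chains[OF assms, of j n]
    by (simp add: P_ss_def chain_series_def fps_X_power_mult_nth m_def)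
  then show "fps_nth (fps_nth (P_ss l i) j) n = fps_nth (fps_X ^ (j\<^sup>2 + (if i = 0 then j else 0))
      * reflected_bailey l (fst (start_cell i)) j) n"
    by (simp only: m_def chain_series_eq_reflected_bailey[OF assms(2) start_cell_props(2)[OF assms]])
qed


section \<open>Convergence and evaluation of the multisum\<close>

text \<open>A limit of formal power series is reached coefficientwise: the coefficient of index
  \<open>j\<close> is settled once a finite set contains the finitely many \<open>a\<close> with
  \<open>d a = j\<close>.\<close>

lemma has_sum_fps_monomials:
  fixes c :: "'b \<Rightarrow> 'a::comm_ring_1"
  assumes fin: "\<And>j. finite {a \<in> A. d a = j}"
    and nth: "\<And>j. fps_nth P j = (\<Sum>a | a \<in> A \<and> d a = j. c a)"
  shows "((\<lambda>a. fps_const (c a) * fps_X ^ d a) has_sum P) A"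
  unfolding has_sum_def
proof (rule tendsto_fpsI)
  fix j
  show "\<forall>\<^sub>F F in finite_subsets_at_top A. fps_nth (\<Sum>a\<in>F. fps_const (c a) * fps_X ^ d a) j = fps_nth P j"
    unfolding eventually_finite_subsets_at_top
  proof (intro exI conjI allI impI)
    show "finite {a \<in> A. d a = j}" by (rule fin)
    fix F assume F: "finite F \<and> {a \<in> A. d a = j} \<subseteq> F \<and> F \<subseteq> A"
    have "fps_nth (\<Sum>a\<in>F. fps_const (c a) * fps_X ^ d a) j = (\<Sum>a\<in>F. if d a = j then c a else 0)"
      by (auto simp: fps_sum_nth fps_X_power_nth intro!: sum.cong)
    also have "\<dots> = (\<Sum>a | a \<in> A \<and> d a = j. c a)"
      using F by (intro sum.mono_neutral_cong_right) auto
    finally show "fps_nth (\<Sum>a\<in>F. fps_const (c a) * fps_X ^ d a) j = fps_nth P j" by (simp add: nth)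
  qed auto
qed

lemma N_part_first: "l \<ge> 1 \<Longrightarrow> N_part l n 1 = n 1 + N_part l n 2"
  unfolding N_part_def by (subst sum.atLeast_Suc_atMost) (simp_all add: numeral_2_eq_2)

lemma N_part_shift:
  "s \<ge> 1 \<Longrightarrow> N_part l (\<lambda>t\<in>{1..l}. n (Suc t)) s = N_part (Suc l) n (Suc s)"
  unfolding N_part_def sum.shift_bounds_cl_Suc_ivl by (intro sum.cong) auto

definition compositions :: "nat \<Rightarrow> nat \<Rightarrow> (nat \<Rightarrow> nat) set" where
  "compositions l j = {n \<in> {1..l} \<rightarrow>\<^sub>E UNIV. N_part l n 1 = j}"

lemma finite_compositions: "finite (compositions l j)"
proof (rule finite_subset)
  show "compositions l j \<subseteq> {1..l} \<rightarrow>\<^sub>E {..j}"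
  proof
    fix n assume n: "n \<in> compositions l j"
    then have "n \<in> extensional {1..l}" and j: "N_part l n 1 = j"
      by (simp_all add: compositions_def PiE_iff)
    moreover have "n s \<le> j" if "s \<in> {1..l}" for s
      unfolding j[symmetric] N_part_def by (rule member_le_sum[OF that]) simp_all
    ultimately show "n \<in> {1..l} \<rightarrow>\<^sub>E {..j}" by (simp only: PiE_iff atMost_iff) blast
  qed
qed (simp add: finite_PiE)

text \<open>The factor of \<open>multisum_term\<close> free of z, with the linear form
  \<open>N_(r+1) + ... + N_l\<close> in place of \<open>L_ss\<close>.\<close>

definition bailey_term :: "nat \<Rightarrow> nat \<Rightarrow> (nat \<Rightarrow> nat) \<Rightarrow> rat fps" where
  "bailey_term l r n = fps_X ^ ((\<Sum>s = 1..l. (N_part l n s)\<^sup>2) + (\<Sum>s = Suc r..l. N_part l n s))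
     * ((\<Prod>s = 1..<l. inv_qp (n s)) * inv_qp2 (n l))"

text \<open>Dropping \<open>n 1\<close> shifts the partial sums: \<open>N_s\<close> of the tail is
  \<open>N_(s+1)\<close> of \<open>n\<close>. What remains is the square of \<open>N_1\<close> and
  the factor of \<open>n 1\<close>.\<close>

lemma bailey_term_Suc:
  assumes "l \<ge> 1"
  shows "bailey_term (Suc l) (Suc r) n =
    fps_X ^ ((N_part (Suc l) n 1)\<^sup>2) * (inv_qp (n 1) * bailey_term l r (\<lambda>t\<in>{1..l}. n (Suc t)))"
proof -
  let ?n = "\<lambda>t\<in>{1..l}. n (Suc t)"
  have "(\<Sum>s = 1..Suc l. (N_part (Suc l) n s)\<^sup>2)
      = (N_part (Suc l) n 1)\<^sup>2 + (\<Sum>s = Suc 1..Suc l. (N_part (Suc l) n s)\<^sup>2)"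
    by (rule sum.atLeast_Suc_atMost) simp
  also have "(\<Sum>s = Suc 1..Suc l. (N_part (Suc l) n s)\<^sup>2) = (\<Sum>s = 1..l. (N_part l ?n s)\<^sup>2)"
    unfolding sum.shift_bounds_cl_Suc_ivl by (intro sum.cong refl) (subst N_part_shift, auto)
  finally have squares: "(\<Sum>s = 1..Suc l. (N_part (Suc l) n s)\<^sup>2)
      = (N_part (Suc l) n 1)\<^sup>2 + (\<Sum>s = 1..l. (N_part l ?n s)\<^sup>2)" .
  have linear: "(\<Sum>s = Suc (Suc r)..Suc l. N_part (Suc l) n s) = (\<Sum>s = Suc r..l. N_part l ?n s)"
    unfolding sum.shift_bounds_cl_Suc_ivl by (intro sum.cong refl) (subst N_part_shift, auto)
  have "(\<Prod>s = 1..<Suc l. inv_qp (n s)) = inv_qp (n 1) * (\<Prod>s = Suc 1..<Suc l. inv_qp (n s))"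
    using assms by (intro prod.atLeast_Suc_lessThan) simp
  also have "(\<Prod>s = Suc 1..<Suc l. inv_qp (n s)) = (\<Prod>s = 1..<l. inv_qp (?n s))"
    unfolding prod.shift_bounds_Suc_ivl by (intro prod.cong) auto
  finally have prods: "(\<Prod>s = 1..<Suc l. inv_qp (n s)) = inv_qp (n 1) * (\<Prod>s = 1..<l. inv_qp (?n s))" .
  have last: "inv_qp2 (n (Suc l)) = inv_qp2 (?n l)" using assms by simp
  show ?thesis
    unfolding bailey_term_def squares linear prods last power_add by (simp only: mult_ac)
qed

lemma bailey_term_0:
  assumes "l \<ge> 1"
  shows "bailey_term l 0 n = fps_X ^ N_part l n 1 * bailey_term l 1 n"
proof -
  have "(\<Sum>s = Suc 0..l. N_part l n s) = N_part l n 1 + (\<Sum>s = Suc 1..l. N_part l n s)"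
    using assms sum.atLeast_Suc_atMost[of 1 l "N_part l n"] by simp
  then show ?thesis
    by (simp only: bailey_term_def power_add mult_ac)
qed

lemma compositions_1: "compositions 1 j = {\<lambda>t\<in>{1}. j}"
proof (intro equalityI subsetI)
  fix n assume "n \<in> compositions 1 j"
  then have "n = (\<lambda>t\<in>{1}. j)"
    by (intro PiE_ext[of n "{1}" "\<lambda>_. UNIV"]) (auto simp: compositions_def N_part_def)
  then show "n \<in> {\<lambda>t\<in>{1}. j}" by simp
qed (simp add: compositions_def N_part_def)

text \<open>The bijection splits off \<open>n 1 = j - m\<close>, where \<open>m\<close> is the sum
  of the remaining entries.\<close>

lemma sum_compositions_Suc:
  fixes g :: "nat \<Rightarrow> (nat \<Rightarrow> nat) \<Rightarrow> 'a::comm_monoid_add"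
  assumes "l \<ge> 1"
  shows "(\<Sum>n\<in>compositions (Suc l) j. g (n 1) (\<lambda>t\<in>{1..l}. n (Suc t)))
    = (\<Sum>m\<le>j. \<Sum>n\<in>compositions l m. g (j - m) n)"
proof -
  define cons where "cons a n = (\<lambda>t\<in>{1..Suc l}. if t = 1 then a else n (t - 1))" for a and n :: "nat \<Rightarrow> nat"
  define tail where "tail n = (\<lambda>t\<in>{1..l}. n (Suc t))" for n :: "nat \<Rightarrow> nat"
  have tail_cons: "tail (cons a n) = n" if "n \<in> {1..l} \<rightarrow>\<^sub>E UNIV" for a n
  proof
    show "tail (cons a n) s = n s" for s
      using PiE_arb[OF that, of s] by (cases "s \<in> {1..l}") (simp_all add: tail_def cons_def)
  qed
  have cons_tail: "cons (n 1) (tail n) = n" if "n \<in> {1..Suc l} \<rightarrow>\<^sub>E UNIV" for n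
  proof
    show "cons (n 1) (tail n) s = n s" for s
      using PiE_arb[OF that, of s] by (cases "s \<in> {1..Suc l}") (auto simp: tail_def cons_def)
  qed
  have first: "N_part (Suc l) n 1 = n 1 + N_part l (tail n) 1" for n
    using N_part_first[of "Suc l" n] N_part_shift[of 1 l n] by (simp add: tail_def numeral_2_eq_2)
  have "(\<Sum>n\<in>compositions (Suc l) j. g (n 1) (tail n))
      = (\<Sum>(m, n)\<in>Sigma {..j} (compositions l). g (j - m) n)"
  proof (rule sum.reindex_bij_witness[where i = "\<lambda>(m, n). cons (j - m) n" and j = "\<lambda>n. (N_part l (tail n) 1, tail n)"])
    fix n assume n: "n \<in> compositions (Suc l) j"
    then have n1: "n 1 = j - N_part l (tail n) 1" "N_part l (tail n) 1 \<le> j"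
      using first[of n] by (auto simp: compositions_def)
    show "(case (N_part l (tail n) 1, tail n) of (m, n) \<Rightarrow> cons (j - m) n) = n"
      using n cons_tail[of n] unfolding n1(1) by (simp add: compositions_def)
    show "(N_part l (tail n) 1, tail n) \<in> Sigma {..j} (compositions l)"
      using n1(2) by (simp add: compositions_def) (simp add: tail_def)
    show "(case (N_part l (tail n) 1, tail n) of (m, n) \<Rightarrow> g (j - m) n) = g (n 1) (tail n)"
      unfolding n1(1) by simp
  next
    fix p assume "p \<in> Sigma {..j} (compositions l)"
    then obtain m n where p: "p = (m, n)" "m \<le> j" "n \<in> {1..l} \<rightarrow>\<^sub>E UNIV" "N_part l n 1 = m"
      by (auto simp: compositions_def)
    show "(N_part l (tail (case p of (m, n) \<Rightarrow> cons (j - m) n)) 1, tail (case p of (m, n) \<Rightarrow> cons (j - m) n)) = p"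
      using p tail_cons by simp
    have "cons (j - m) n 1 = j - m" by (simp add: cons_def)
    then show "(case p of (m, n) \<Rightarrow> cons (j - m) n) \<in> compositions (Suc l) j"
      using p tail_cons[of n "j - m"] first[of "cons (j - m) n"] by (simp add: compositions_def) (simp add: cons_def)
  qed
  then show ?thesis
    by (simp add: tail_def sum.Sigma finite_compositions)
qed

text \<open>Grouping the indices by \<open>N_2 = m\<close> at fixed \<open>N_1 = j\<close> exhibits
  one Bailey step: \<open>n 1 = j - m\<close> gives \<open>inv_qp (j - m)\<close>, and the induction
  hypothesis gives \<open>q ^ m\<^sup>2\<close> and the series of the row below.\<close>

lemma sum_bailey_term:
  "(\<Sum>n\<in>compositions (Suc l) j. bailey_term (Suc l) r n) = fps_X ^ (j\<^sup>2) * bailey l r j"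
proof (induction l arbitrary: r j)
  case 0
  have "bailey_term 1 r (\<lambda>t\<in>{1}. j) = fps_X ^ (j\<^sup>2) * bailey 0 r j"
    by (cases r) (auto simp: bailey_term_def N_part_def power_add mult_ac)
  then show ?case
    unfolding One_nat_def[symmetric] compositions_1 by (simp del: One_nat_def restrict_apply)
next
  case (Suc l)
  have step: "(\<Sum>n\<in>compositions (Suc (Suc l)) j. bailey_term (Suc (Suc l)) (Suc r) n)
      = fps_X ^ (j\<^sup>2) * bailey (Suc l) (Suc r) j" for r
  proof -
    have "(\<Sum>n\<in>compositions (Suc (Suc l)) j. bailey_term (Suc (Suc l)) (Suc r) n)
      = (\<Sum>n\<in>compositions (Suc (Suc l)) j. fps_X ^ (j\<^sup>2) *
          (inv_qp (n 1) * bailey_term (Suc l) r (\<lambda>t\<in>{1..Suc l}. n (Suc t))))"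
      by (intro sum.cong refl, subst bailey_term_Suc) (auto simp: compositions_def)
    also have "\<dots> = (\<Sum>m\<le>j. \<Sum>n\<in>compositions (Suc l) m. fps_X ^ (j\<^sup>2) * (inv_qp (j - m) * bailey_term (Suc l) r n))"
      by (rule sum_compositions_Suc) simp
    also have "\<dots> = fps_X ^ (j\<^sup>2) * bailey (Suc l) (Suc r) j"
      by (simp only: sum_distrib_left[symmetric] Suc.IH bailey.simps) (simp add: mult_ac)
    finally show ?thesis .
  qed
  show ?case
  proof (cases r)
    case 0
    have "(\<Sum>n\<in>compositions (Suc (Suc l)) j. bailey_term (Suc (Suc l)) 0 n)
      = fps_X ^ j * (\<Sum>n\<in>compositions (Suc (Suc l)) j. bailey_term (Suc (Suc l)) 1 n)"
      unfolding sum_distrib_left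
      by (intro sum.cong refl, subst bailey_term_0) (auto simp: compositions_def)
    also have "\<dots> = fps_X ^ (j\<^sup>2) * bailey (Suc l) 0 j"
      using step[of 0] bailey_row_0[of "Suc l" j] by (simp add: mult_ac del: bailey.simps)
    finally show ?thesis by (simp only: 0)
  qed (simp only: step)
qed

lemma fps_inverse_prod:
  fixes f :: "'b \<Rightarrow> 'a::field fps"
  shows "inverse (\<Prod>s\<in>A. f s) = (\<Prod>s\<in>A. inverse (f s))"
  by (induction A rule: infinite_finite_induct) (simp_all add: fps_inverse_mult)

lemma qpoch_nth_0: "fps_nth a 0 = 0 \<Longrightarrow> fps_nth (qpoch a q n) 0 = 1"
  by (induction n) (simp_all add: qpoch_def)

lemma prod_nth_0_eq_1: "(\<And>s. s \<in> A \<Longrightarrow> fps_nth (f s) 0 = 1) \<Longrightarrow> fps_nth (\<Prod>s\<in>A. f s) 0 = 1"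
  by (induction A rule: infinite_finite_induct) simp_all

lemma multisum_denominator:
  "a / ((\<Prod>s = 1..<l. qpoch fps_X fps_X (n s)) * qpoch (fps_X\<^sup>2) (fps_X\<^sup>2) (n l))
    = a * ((\<Prod>s = 1..<l. inv_qp (n s)) * inv_qp2 (n l))" (is "a / ?D = _")
proof -
  have "fps_nth ?D 0 = 1"
    by (simp add: qpoch_nth_0 prod_nth_0_eq_1 power2_eq_square)
  then have "a / ?D = a * inverse ?D" by (intro fps_divide_unit) simp
  then show ?thesis
    by (simp add: fps_inverse_mult fps_inverse_prod inv_qp_def inv_qp2_def)
qed


text \<open>The cases of \<open>L_ss\<close> are row 0, the rows \<open>2 * i - 1 < l\<close>, and
  the rows \<open>2 * i - 1 \<ge> l\<close>, whose mirror image is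
  \<open>2 * (l - i) + 1\<close>.\<close>

lemma multisum_term_eq:
  assumes "l \<ge> 1" "i \<le> l"
  defines "r \<equiv> fst (start_cell i)"
  shows "multisum_term l i n = fps_const (fps_X ^ (if i = 0 then N_part l n 1 else 0)
      * bailey_term l (if r \<le> l then r else 2 * l - r) n) * fps_X ^ N_part l n 1"
proof -
  have "L_ss l i (N_part l n) = (if i = 0 then N_part l n 1 else 0)
      + (\<Sum>s = Suc (if r \<le> l then r else 2 * l - r)..l. N_part l n s)"
  proof (cases "i = 0 \<or> 2 * i \<le> l")
    case True
    have "(\<Sum>s = 2 * i..l. N_part l n s) = N_part l n (2 * i) + (\<Sum>s = Suc (2 * i)..l. N_part l n s)" if "2 * i \<le> l"
      using that by (rule sum.atLeast_Suc_atMost)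
    with True show ?thesis
      by (auto simp: L_ss_def r_def start_cell_def)
  next
    case False
    then have "2 * (l - i) + 2 = Suc (if r \<le> l then r else 2 * l - r)"
      using assms by (auto simp: start_cell_def)
    then show ?thesis using False by (simp add: L_ss_def)
  qed
  then show ?thesis
    unfolding multisum_term_def multisum_denominator bailey_term_def
    by (simp add: power_add mult_ac)
qed

theorem theorem5:
  fixes l i :: nat
  assumes "l \<ge> 1" and "i \<le> l"
  shows "(multisum_term l i has_sum P_ss l i) ({1..l} \<rightarrow>\<^sub>E (UNIV :: nat set))"
proof -
  let ?r = "fst (start_cell i)"
  let ?r' = "if ?r \<le> l then ?r else 2 * l - ?r"
  let ?c = "\<lambda>n. fps_X ^ (if i = 0 then N_part l n 1 else 0) * bailey_term l ?r' n"
  have comp: "{n. n \<in> {1..l} \<rightarrow>\<^sub>E UNIV \<and> N_part l n 1 = j} = compositions l j" for j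
    by (simp add: compositions_def)
  have "((\<lambda>n. fps_const (?c n) * fps_X ^ N_part l n 1) has_sum P_ss l i) ({1..l} \<rightarrow>\<^sub>E UNIV)"
  proof (rule has_sum_fps_monomials)
    fix j
    show "finite {n \<in> {1..l} \<rightarrow>\<^sub>E UNIV. N_part l n 1 = j}"
      unfolding comp by (rule finite_compositions)
    \<comment> \<open>On the indices with \<open>N_1 = j\<close> the extra factor for
      \<open>i = 0\<close> is the constant \<open>q ^ j\<close>, as for chains that start in column
      0.\<close>
    have "(\<Sum>n\<in>compositions l j. ?c n)
        = fps_X ^ (if i = 0 then j else 0) * (\<Sum>n\<in>compositions l j. bailey_term l ?r' n)"
      unfolding sum_distrib_left by (intro sum.cong refl) (simp add: compositions_def)
    also have "(\<Sum>n\<in>compositions l j. bailey_term l ?r' n) = fps_X ^ (j\<^sup>2) * reflected_bailey l ?r j"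
      using sum_bailey_term[where l = "l - 1" and j = j and r = ?r'] assms(1) by (simp add: reflected_bailey_def)
    finally show "fps_nth (P_ss l i) j = (\<Sum>n | n \<in> {1..l} \<rightarrow>\<^sub>E UNIV \<and> N_part l n 1 = j. ?c n)"
      unfolding comp P_ss_nth[OF assms(2,1)] by (simp add: power_add mult_ac)
  qed
  moreover have "multisum_term l i = (\<lambda>n. fps_const (?c n) * fps_X ^ N_part l n 1)"
    by (rule ext) (rule multisum_term_eq[OF assms])
  ultimately show ?thesis by (simp only:)
qed

end
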